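(* Let $G$ be an edge-colored graph of order $n$. If for every vertex $v$ of $G$, $d^c(v)>\frac{n+5}{2}$, then $G$ contains a rainbow cycle of length at least four.
   Context: All graphs are finite, simple and undirected. An edge-colored graph is a graph $G$ together with an arbitrary mapping $c:E(G)\to\mathbb{N}$ (not required to be a proper coloring). The order of $G$ is $|V(G)|$. The color-degree $d^c(v)$ of a vertex $v$ is the number of distinct colors on the edges incident to $v$. A subgraph of $G$ is rainbow if its edges have pairwise distinct colors. The length of a cycle is its number of edges. *)

theory Defs
  imports Complex_Main "Graph_Theory.Pair_Digraph" "Graph_Theory.Arc_Walk"
begin

text \<open>
  Finite simple undirected graphs are taken as \<^locale>\<open>pair_graph\<close>s, in which an undirected edge
  appears as the two opposite arcs \<open>(u, v)\<close> and \<open>(v, u)\<close>. Colors are attached to the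
  undirected edge, the two-element set \<open>{u, v}\<close>, so both arcs carry the same color.
\<close>

definition uedge :: "'a \<times> 'a \<Rightarrow> 'a set" where
  "uedge a = {fst a, snd a}"

definition edges :: "'a pair_pre_digraph \<Rightarrow> 'a set set" where
  "edges G = uedge ` parcs G"

text \<open>
  An edge coloring of \<open>G\<close> is a function \<open>c :: 'a set \<Rightarrow> nat\<close>, of which only the values on
  \<open>edges G\<close> matter.
\<close>

definition color_degree :: "'a pair_pre_digraph \<Rightarrow> ('a set \<Rightarrow> nat) \<Rightarrow> 'a \<Rightarrow> nat" where
  "color_degree G c v = card (c ` {e \<in> edges G. v \<in> e})"

definition rainbow :: "('a set \<Rightarrow> nat) \<Rightarrow> 'a set set \<Rightarrow> bool" where
  "rainbow c F \<longleftrightarrow> inj_on c F"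

text \<open>
  The library's \<^const>\<open>pre_digraph.cycle\<close> is a directed cycle, given as its list of arcs. Closed
  walks \<open>[(u, v), (v, u)]\<close> along a single edge count as cycles there; from length 3 on
  the vertices are distinct and the arcs are the edges of an undirected cycle,
  each traversed once, so the length of the list is the number of edges.
\<close>

definition rainbow_cycle ::
  "'a pair_pre_digraph \<Rightarrow> ('a set \<Rightarrow> nat) \<Rightarrow> ('a \<times> 'a) awalk \<Rightarrow> bool" where
  "rainbow_cycle G c p \<longleftrightarrow>
     pre_digraph.cycle (with_proj G) p \<and> 3 \<le> length p \<and> rainbow c (uedge ` set p)"

end

theory Submission
  imports Defs
begin

text \<open>
  Suppose that no rainbow cycle has length at least four, and take a rainbow path
  \<open>v\<^sub>0, \<dots>, v\<^sub>k\<close> of maximal length; the conclusion will be that the color degrees of its two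
  ends add up to at most \<open>n + 5\<close>, which is less than the hypothesis allows.

  Set aside the colors of \<open>v\<^sub>0v\<^sub>2\<close> and of \<open>v\<^sub>kv\<^bsub>k-2\<^esub>\<close>. Every other edge at an end has one of
  the \<open>k\<close> colors of the path: if it leaves the path, because the path is longest, and if it is a
  chord, because otherwise it closes a rainbow cycle of length at least four. More precisely, the
  color of a chord reappears on the stretch of path that the chord spans. Split the colors at
  \<open>v\<^sub>0\<close> into the set \<open>A\<^sub>1\<close> of those seen on some edge into the path and the set \<open>A\<^sub>2\<close> of the
  others, which are seen only on edges to the \<open>n - k - 1\<close> vertices off the path; define
  \<open>B\<^sub>1\<close> and \<open>B\<^sub>2\<close> in the same way at \<open>v\<^sub>k\<close>. Two facts bound the four sizes.

  \<^item> \<open>A\<^sub>1 \<inter> B\<^sub>1\<close> has at most three elements. If two colors lie in it, then the earlier one, used by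
    \<open>v\<^sub>kv\<^sub>b\<close>, and the later one, used by \<open>v\<^sub>0v\<^sub>a\<close>, have their path edges between \<open>v\<^sub>b\<close> and
    \<open>v\<^sub>a\<close>, so \<open>v\<^sub>b, \<dots>, v\<^sub>0, v\<^sub>a, \<dots>, v\<^sub>k, v\<^sub>b\<close> is a rainbow cycle, unless it is too short. It is
    long when \<open>a \<le> k - 2\<close>. Hence all colors but the earliest belong to \<open>v\<^sub>0v\<^bsub>k-1\<^esub>\<close> or \<open>v\<^sub>0v\<^sub>k\<close>.

  \<^item> \<open>|A\<^sub>2| + |B\<^sub>2| \<le> (n - k - 1) + |A\<^sub>2 \<inter> B\<^sub>2| + 1\<close>. Choose for every color a vertex off the path.
    A vertex \<open>w\<close> chosen from both ends is a common neighbor, and two of them form a four-cycle with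
    \<open>v\<^sub>0\<close> and \<open>v\<^sub>k\<close>. If neither color at \<open>v\<^sub>0\<close> is in \<open>B\<^sub>2\<close>, this cycle is rainbow. So all but
    one of the vertices chosen twice give different elements of \<open>A\<^sub>2 \<inter> B\<^sub>2\<close>.

  The sets \<open>A\<^sub>1 \<union> B\<^sub>1\<close> and \<open>A\<^sub>2 \<inter> B\<^sub>2\<close> are disjoint sets of path colors, so together they have at
  most \<open>k\<close> elements. Adding up, the four sizes sum to at most \<open>k + 3 + (n - k - 1) + 1 = n + 3\<close>,
  and the two colors set aside contribute two more.
\<close>

section \<open>Rainbow paths\<close>

fun arcs_along :: "'a list \<Rightarrow> ('a \<times> 'a) list" where
  "arcs_along (x # y # xs) = (x, y) # arcs_along (y # xs)"
| "arcs_along _ = []"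

lemma length_arcs_along [simp]: "length (arcs_along xs) = length xs - 1"
  by (induction xs rule: arcs_along.induct) auto

lemma arcs_along_append:
  "xs \<noteq> [] \<Longrightarrow> ys \<noteq> [] \<Longrightarrow>
    arcs_along (xs @ ys) = arcs_along xs @ (last xs, hd ys) # arcs_along ys"
  by (induction xs rule: arcs_along.induct) (auto simp: neq_Nil_conv)

lemma arcs_along_take: "arcs_along (take (Suc n) xs) = take n (arcs_along xs)"
proof (induction xs arbitrary: n rule: arcs_along.induct)
  case (1 x y xs)
  then show ?case by (cases n) auto
qed auto

lemma arcs_along_drop: "arcs_along (drop n xs) = drop n (arcs_along xs)"
proof (induction xs arbitrary: n rule: arcs_along.induct)
  case (1 x y xs)
  then show ?case by (cases n) auto
next
  case ("2_2" v)
  then show ?case by (cases n) auto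
qed auto

lemma pcas_arcs_along: "xs \<noteq> [] \<Longrightarrow> pcas (hd xs) (arcs_along xs) (last xs)"
  by (induction xs rule: arcs_along.induct) auto

lemma pawalk_verts_arcs_along: "xs \<noteq> [] \<Longrightarrow> pawalk_verts (hd xs) (arcs_along xs) = xs"
  by (induction xs rule: arcs_along.induct) auto

lemma uedge_Pair [simp]: "uedge (x, y) = {x, y}"
  by (simp add: uedge_def)

locale edge_colored_graph = pair_graph G
  for G :: "'a pair_pre_digraph" +
  fixes c :: "'a set \<Rightarrow> nat"
begin

definition path_colors :: "'a list \<Rightarrow> nat list" where
  "path_colors xs = map (\<lambda>a. c (uedge a)) (arcs_along xs)"

definition rainbow_path :: "'a list \<Rightarrow> bool" where
  "rainbow_path xs \<longleftrightarrow> xs \<noteq> [] \<and> set xs \<subseteq> pverts G \<and> set (arcs_along xs) \<subseteq> parcs G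
     \<and> distinct xs \<and> distinct (path_colors xs)"

lemma length_path_colors [simp]: "length (path_colors xs) = length xs - 1"
  by (simp add: path_colors_def)

lemma path_colors_append:
  "xs \<noteq> [] \<Longrightarrow> ys \<noteq> [] \<Longrightarrow>
    path_colors (xs @ ys) = path_colors xs @ c {last xs, hd ys} # path_colors ys"
  by (simp add: path_colors_def arcs_along_append)

lemma path_colors_take: "path_colors (take (Suc n) xs) = take n (path_colors xs)"
  by (simp add: path_colors_def arcs_along_take take_map)

lemma path_colors_drop: "path_colors (drop n xs) = drop n (path_colors xs)"
  by (simp add: path_colors_def arcs_along_drop drop_map)

lemma path_colors_singleton [simp]: "path_colors [x] = []"
  by (simp add: path_colors_def)

lemma path_colors_rev: "path_colors (rev xs) = rev (path_colors xs)"
proof (induction xs)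
  case (Cons x xs)
  show ?case
  proof (cases "xs = []")
    case False
    then show ?thesis
      using Cons path_colors_append[of "rev xs" "[x]"] path_colors_append[of "[x]" xs]
      by (simp add: last_rev insert_commute)
  qed auto
qed (simp add: path_colors_def)

lemma rainbow_path_singleton: "x \<in> pverts G \<Longrightarrow> rainbow_path [x]"
  by (simp add: rainbow_path_def)

lemma rainbow_path_append:
  assumes "rainbow_path xs" "rainbow_path ys" "set xs \<inter> set ys = {}"
    and "(last xs, hd ys) \<in> parcs G"
    and "distinct (path_colors xs @ c {last xs, hd ys} # path_colors ys)"
  shows "rainbow_path (xs @ ys)"
  using assms unfolding rainbow_path_def
  by (auto simp: arcs_along_append path_colors_append)

lemma rainbow_path_take:
  assumes "rainbow_path xs"
  shows "rainbow_path (take (Suc n) xs)"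
  using assms unfolding rainbow_path_def path_colors_take arcs_along_take
  by (auto dest: in_set_takeD)

lemma rainbow_path_drop:
  assumes "rainbow_path xs" "n < length xs"
  shows "rainbow_path (drop n xs)"
  using assms unfolding rainbow_path_def path_colors_drop arcs_along_drop
  by (auto dest: in_set_dropD)

lemma arcs_along_rev_subset:
  "set (arcs_along xs) \<subseteq> parcs G \<Longrightarrow> set (arcs_along (rev xs)) \<subseteq> parcs G"
proof (induction xs)
  case (Cons x xs)
  show ?case
  proof (cases "xs = []")
    case False
    then show ?thesis
      using Cons arcs_along_append[of "rev xs" "[x]"] arcs_along_append[of "[x]" xs]
      by (auto simp: last_rev intro: arcs_symmetric)
  qed auto
qed simp

lemma rainbow_path_rev: "rainbow_path xs \<Longrightarrow> rainbow_path (rev xs)"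
  using arcs_along_rev_subset[of xs] by (auto simp: rainbow_path_def path_colors_rev)

text \<open>
  All cycles below are obtained by closing a rainbow path with one more edge, so that rainbow paths
  and their color lists are enough to work with.
\<close>

lemma rainbow_cycle_if_rainbow_path_closes:
  assumes path: "rainbow_path us" and "3 \<le> length us"
    and arc: "(last us, hd us) \<in> parcs G"
    and new: "c {last us, hd us} \<notin> set (path_colors us)"
  shows "\<exists>p. rainbow_cycle G c p \<and> length p = length us"
proof -
  define p where "p = arcs_along (us @ [hd us])"
  have ne: "us \<noteq> []" using path by (simp add: rainbow_path_def)
  have p: "p = arcs_along us @ [(last us, hd us)]"
    using ne arcs_along_append[of us "[hd us]"] by (simp add: p_def)
  have len: "length p = length us"
    using ne by (simp add: p_def)
  have hd: "hd (us @ [hd us]) = hd us" using ne by simp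
  have "awalk (hd us) p (hd us)"
    using path arc pcas_arcs_along[of "us @ [hd us]"] ne
    by (auto simp: awalk_def rainbow_path_def p simp flip: p_def)
  moreover have "pawalk_verts (hd us) p = us @ [hd us]"
    using pawalk_verts_arcs_along[of "us @ [hd us]"] ne by (simp add: p_def)
  then have "distinct (tl (pawalk_verts (hd us) p))"
    using path ne by (cases us) (auto simp: rainbow_path_def)
  moreover have "p \<noteq> []" by (simp add: p)
  ultimately have "cycle p"
    unfolding cycle_def by auto
  moreover have "distinct (map (\<lambda>a. c (uedge a)) p)"
    using path new by (simp add: p rainbow_path_def path_colors_def)
  then have "inj_on (c \<circ> uedge) (set p)"
    by (simp add: distinct_map comp_def)
  then have "rainbow c (uedge ` set p)"
    unfolding rainbow_def by (rule inj_on_imageI)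
  ultimately show ?thesis
    using len assms(2) unfolding rainbow_cycle_def by auto
qed

lemma color_degree_eq: "color_degree G c v = card ((\<lambda>w. c {v, w}) ` {w. (v, w) \<in> parcs G})"
proof -
  have "{e \<in> edges G. v \<in> e} = (\<lambda>w. {v, w}) ` {w. (v, w) \<in> parcs G}"
    unfolding edges_def by (auto simp: uedge_def image_iff insert_commute intro: arcs_symmetric)
      (metis arcs_symmetric fst_conv insert_commute snd_conv)+
  then show ?thesis
    by (simp add: color_degree_def image_image)
qed

lemma longest_rainbow_path_exists:
  assumes "pverts G \<noteq> {}"
  obtains vs where "rainbow_path vs" "\<And>us. rainbow_path us \<Longrightarrow> length us \<le> length vs"
proof -
  obtain x where "x \<in> pverts G" using assms by auto
  then have ex: "rainbow_path [x]" by (rule rainbow_path_singleton)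
  have "length us < Suc (card (pverts G))" if "rainbow_path us" for us
    using that card_mono[OF pair_finite_verts, of "set us"]
    by (simp add: rainbow_path_def distinct_card)
  then show ?thesis
    using ex_has_greatest_nat[of rainbow_path "[x]" length "Suc (card (pverts G))"] ex that
    by (metis less_imp_le)
qed

end

section \<open>Counting colors with common representatives\<close>

lemma card_le_Suc_if_subset_insert:
  assumes "A \<subseteq> insert x B" "finite B"
  shows "card A \<le> card B + 1"
  using card_mono[OF _ assms(1)] assms(2) by (auto simp: card_insert_if split: if_splits)

text \<open>
  Here \<open>p w\<close> and \<open>q w\<close> are the colors of the edges from \<open>w\<close> to two fixed vertices, and the clash
  says that no two common neighbors of these vertices form a rainbow four-cycle with them.
  Representatives are chosen injectively for \<open>A\<close> and for \<open>B\<close>. Two doubly chosen vertices whose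
  \<open>p\<close>-color avoids \<open>B\<close> would violate the clash, so \<open>p\<close> maps all but one of the doubly chosen
  vertices injectively into \<open>A \<inter> B\<close>.
\<close>

lemma card_add_le_if_common_reps_clash:
  fixes p q :: "'a \<Rightarrow> 'b"
  assumes "finite W" "P \<subseteq> W" "Q \<subseteq> W" and A: "A \<subseteq> p ` P" and B: "B \<subseteq> q ` Q"
    and clash: "\<And>w w'. w \<in> P \<inter> Q \<Longrightarrow> w' \<in> P \<inter> Q \<Longrightarrow> w \<noteq> w' \<Longrightarrow> \<not> distinct [p w, q w, q w', p w']"
  shows "card A + card B \<le> card W + card (A \<inter> B) + 1"
proof -
  obtain U where U: "U \<subseteq> P" "inj_on p U" "A = p ` U"
    using A by (meson subset_image_inj)
  obtain V where V: "V \<subseteq> Q" "inj_on q V" "B = q ` V"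
    using B by (meson subset_image_inj)
  have fin: "finite U" "finite V"
    using U V assms(1-3) by (meson finite_subset subset_trans)+
  \<comment> \<open>The doubly chosen vertices whose \<open>p\<close>-color cannot be charged to \<open>A \<inter> B\<close>.\<close>
  define T where "T = {w \<in> U \<inter> V. p w \<notin> B}"
  have "card T \<le> Suc 0"
  proof (rule card_le_Suc0_iff_eq[THEN iffD2])
    show "finite T" using fin by (simp add: T_def)
    show "\<forall>w\<in>T. \<forall>w'\<in>T. w = w'"
    proof (intro ballI, rule ccontr)
      fix w w' assume w: "w \<in> T" "w' \<in> T" "w \<noteq> w'"
      have "p w \<noteq> p w'" using w U(2) by (auto simp: T_def inj_on_def)
      moreover have "q w \<noteq> q w'" using w V(2) by (auto simp: T_def inj_on_def)
      moreover have "{q w, q w'} \<subseteq> B" "p w \<notin> B" "p w' \<notin> B" using w V(3) by (auto simp: T_def)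
      ultimately have "distinct [p w, q w, q w', p w']" by auto
      then show False using clash[of w w'] w U(1) V(1) by (auto simp: T_def)
    qed
  qed
  moreover have "card (U \<inter> V - T) \<le> card (A \<inter> B)"
  proof (rule card_inj_on_le[where f = p])
    show "inj_on p (U \<inter> V - T)" using U(2) by (auto simp: inj_on_def)
    show "p ` (U \<inter> V - T) \<subseteq> A \<inter> B" using U(3) by (auto simp: T_def)
    show "finite (A \<inter> B)" using U(3) fin by simp
  qed
  moreover have "card (U \<inter> V) = card T + card (U \<inter> V - T)"
    using fin by (subst card_Un_disjoint[symmetric]) (auto simp: T_def intro!: arg_cong[where f = card])
  moreover have "card (U \<union> V) \<le> card W"
    using U V assms by (intro card_mono) auto
  moreover have "card U + card V = card (U \<union> V) + card (U \<inter> V)"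
    using fin by (rule card_Un_Int)
  moreover have "card A = card U" "card B = card V"
    using U V by (auto simp: card_image)
  ultimately show ?thesis by linarith
qed

section \<open>Colors at the ends of a longest rainbow path\<close>

locale longest_rainbow_path = edge_colored_graph G c
  for G :: "'a pair_pre_digraph" and c +
  fixes vs :: "'a list"
  assumes path: "rainbow_path vs"
    and longest: "\<And>us. rainbow_path us \<Longrightarrow> length us \<le> length vs"
    and no_long_cycle: "\<And>p. rainbow_cycle G c p \<Longrightarrow> length p < 4"
begin

abbreviation k :: nat where "k \<equiv> length vs - 1"
abbreviation cols :: "nat list" where "cols \<equiv> path_colors vs"

lemma vs_ne: "vs \<noteq> []" and dist: "distinct vs" and dist_cols: "distinct cols"
  using path by (auto simp: rainbow_path_def)

lemma length_vs: "length vs = Suc k" using vs_ne by (cases vs) auto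

lemma hd_vs: "hd vs = vs ! 0" and last_vs: "last vs = vs ! k"
  using vs_ne by (auto simp: hd_conv_nth last_conv_nth)

lemma closing_color_used:
  assumes "rainbow_path us" "4 \<le> length us" "(last us, hd us) \<in> parcs G"
  shows "c {last us, hd us} \<in> set (path_colors us)"
  using rainbow_cycle_if_rainbow_path_closes[of us] assms no_long_cycle
  by fastforce

text \<open>
  A chord from the first vertex to position \<open>a \<ge> 3\<close> closes a cycle of length \<open>a + 1\<close>, and for
  \<open>a = 1\<close> the edge lies on the path. Position 2 is left out since the cycle is only a triangle.
  Note that \<open>cols ! i\<close> is the color of the path edge from position \<open>i\<close> to \<open>i + 1\<close>, so that the
  first \<open>a\<close> colors are those before position \<open>a\<close>.
\<close>

lemma first_chord_color:
  assumes "(vs ! 0, vs ! a) \<in> parcs G" "a \<le> k" "a \<noteq> 2"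
  shows "c {vs ! 0, vs ! a} \<in> set (take a cols)"
proof -
  have "a \<noteq> 0" using no_loops'[OF assms(1)] by metis
  then consider "a = 1" | "3 \<le> a" using assms(3) by linarith
  then show ?thesis
  proof cases
    case 1
    then obtain x y zs where "vs = x # y # zs"
      using assms(2) length_vs by (metis One_nat_def Suc_le_length_iff Suc_le_mono)
    then show ?thesis using 1 by (simp add: path_colors_def)
  next
    case 2
    have "hd (take (Suc a) vs) = vs ! 0" using vs_ne hd_vs by simp
    moreover have "last (take (Suc a) vs) = vs ! a"
      using assms(2) length_vs by (subst take_Suc_conv_app_nth) auto
    moreover have "4 \<le> length (take (Suc a) vs)" using 2 assms(2) length_vs by simp
    ultimately show ?thesis
      using closing_color_used[OF rainbow_path_take[OF path], of a] assms(1)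
      by (auto simp: path_colors_take insert_commute intro: arcs_symmetric)
  qed
qed

lemma last_chord_color:
  assumes "(vs ! k, vs ! b) \<in> parcs G" "b \<le> k" "b \<noteq> k - 2"
  shows "c {vs ! k, vs ! b} \<in> set (drop b cols)"
proof -
  have "b \<noteq> k" using no_loops'[OF assms(1)] by metis
  then consider "b + 1 = k" | "b + 3 \<le> k" using assms(2,3) by linarith
  then show ?thesis
  proof cases
    case 1
    then have "drop b vs = [vs ! b, vs ! k]"
      using length_vs by (metis Cons_nth_drop_Suc Suc_eq_plus1 drop_all le_refl lessI less_SucI)
    then have "drop b cols = [c {vs ! b, vs ! k}]"
      unfolding path_colors_drop[symmetric] by (simp add: path_colors_def)
    then show ?thesis by (simp add: insert_commute)
  next
    case 2
    have "hd (drop b vs) = vs ! b" using 2 by (simp add: hd_drop_conv_nth)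
    moreover have "last (drop b vs) = vs ! k" using 2 by (simp add: last_drop last_vs)
    moreover have "4 \<le> length (drop b vs)" using 2 by simp
    ultimately show ?thesis
      using closing_color_used[OF rainbow_path_drop[OF path], of b] assms(1) 2
      by (auto simp: path_colors_drop)
  qed
qed

lemma first_outside_color:
  assumes "(vs ! 0, w) \<in> parcs G" "w \<notin> set vs"
  shows "c {vs ! 0, w} \<in> set cols"
proof (rule ccontr)
  assume "c {vs ! 0, w} \<notin> set cols"
  then have "rainbow_path ([w] @ vs)"
    using assms path dist_cols
    by (intro rainbow_path_append)
      (auto simp: hd_vs insert_commute intro: rainbow_path_singleton arcs_symmetric dest: in_arcsD2)
  then show False using longest by fastforce
qed

lemma last_outside_color:
  assumes "(vs ! k, w) \<in> parcs G" "w \<notin> set vs"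
  shows "c {vs ! k, w} \<in> set cols"
proof (rule ccontr)
  assume "c {vs ! k, w} \<notin> set cols"
  then have "rainbow_path (vs @ [w])"
    using assms path dist_cols
    by (intro rainbow_path_append)
      (auto simp: last_vs intro: rainbow_path_singleton dest: in_arcsD2)
  then show False using longest by fastforce
qed

text \<open>
  The chords cross: one goes from the first vertex far forward to position \<open>a\<close>, the other from the
  last vertex far back to position \<open>b < a\<close>. Leaving out the path between \<open>b\<close> and \<open>a\<close>, which
  carries both chord colors, gives a rainbow cycle of length \<open>b + k - a + 2\<close>,
  which is at least four when \<open>a + 2 \<le> k\<close>.
\<close>

lemma crossing_chords:
  assumes a: "(vs ! 0, vs ! a) \<in> parcs G" "a \<le> k" "c {vs ! 0, vs ! a} = cols ! q"
    and b: "(vs ! k, vs ! b) \<in> parcs G" "c {vs ! k, vs ! b} = cols ! p"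
    and order: "b \<le> p" "p < q" "q < a"
  shows "k \<le> a + 1"
proof (rule ccontr)
  assume "\<not> k \<le> a + 1"
  then have far: "a + 2 \<le> k" by simp
  define us where "us = rev (take (Suc b) vs) @ drop a vs"
  have in_cols: "q < length cols" using a(2) order by simp
  have ends: "hd (drop a vs) = vs ! a" "last (rev (take (Suc b) vs)) = vs ! 0"
    "last us = vs ! k" "hd us = vs ! b"
    using vs_ne far order length_vs
    by (auto simp: us_def hd_drop_conv_nth last_rev hd_vs hd_rev last_drop last_vs
        last_conv_nth[of "take (Suc b) vs"])
  have indices: "cols ! i \<notin> set (take b cols)" "cols ! i \<notin> set (drop a cols)"
    if "i = p \<or> i = q" for i
    using that order in_cols dist_cols
    by (auto simp: in_set_conv_nth nth_eq_iff_index_eq)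
  have disj: "set (take b cols) \<inter> set (drop a cols) = {}"
    using order dist_cols by (intro set_take_disj_set_drop_if_distinct) auto
  have "rainbow_path us"
    unfolding us_def
  proof (rule rainbow_path_append)
    show "set (rev (take (Suc b) vs)) \<inter> set (drop a vs) = {}"
      using order dist set_take_disj_set_drop_if_distinct[of vs "Suc b" a] by simp
    show "distinct (path_colors (rev (take (Suc b) vs)) @
      c {last (rev (take (Suc b) vs)), hd (drop a vs)} # path_colors (drop a vs))"
      using ends a indices[of q] dist_cols disj
      by (auto simp: path_colors_rev path_colors_take path_colors_drop)
  qed (use path a far ends in \<open>auto intro: rainbow_path_rev rainbow_path_take rainbow_path_drop\<close>)
  moreover have "4 \<le> length us" using far order length_vs by (simp add: us_def)
  ultimately have "c {vs ! k, vs ! b} \<in> set (path_colors us)"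
    using closing_color_used[of us] b(1) ends by simp
  moreover have "path_colors us = rev (take b cols) @ cols ! q # drop a cols"
    using ends(1,2) a vs_ne far
    by (simp add: us_def path_colors_append path_colors_rev path_colors_take path_colors_drop)
  ultimately show False
    using b(2) indices[of p] order in_cols dist_cols by (auto simp: nth_eq_iff_index_eq)
qed

text \<open>
  The colors at the two ends, apart from that of the edge to the vertex at distance two along the
  path. A color seen both on and off the path counts as inner, so that the outer colors of an end
  are disjoint from its inner ones. If the path is too short for a vertex at distance two, the
  excluded index is harmless, because at most one color per end is lost in any case.
\<close>

definition first_inner :: "nat set" where
  "first_inner = {c {vs ! 0, vs ! a} | a. (vs ! 0, vs ! a) \<in> parcs G \<and> a \<le> k \<and> a \<noteq> 2}"

definition last_inner :: "nat set" where
  "last_inner = {c {vs ! k, vs ! b} | b. (vs ! k, vs ! b) \<in> parcs G \<and> b \<le> k \<and> b \<noteq> k - 2}"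

definition first_outer :: "nat set" where
  "first_outer = {c {vs ! 0, w} | w. (vs ! 0, w) \<in> parcs G \<and> w \<notin> set vs} - first_inner"

definition last_outer :: "nat set" where
  "last_outer = {c {vs ! k, w} | w. (vs ! k, w) \<in> parcs G \<and> w \<notin> set vs} - last_inner"

lemma subsets_cols:
  "first_inner \<subseteq> set cols" "last_inner \<subseteq> set cols"
  "first_outer \<subseteq> set cols" "last_outer \<subseteq> set cols"
  using first_chord_color last_chord_color first_outside_color last_outside_color
  by (fastforce simp: first_inner_def last_inner_def first_outer_def last_outer_def
      dest: in_set_takeD in_set_dropD)+

text \<open>
  Take the common color that comes first along the path and let its chord start at the last vertex.
  Any later common color then belongs to a crossing chord at the first vertex, which must end at one
  of the last two positions.
\<close>

lemma card_inner_Int: "card (first_inner \<inter> last_inner) \<le> 3"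
proof (cases "first_inner \<inter> last_inner = {}")
  case False
  let ?P = "\<lambda>p. p < k \<and> cols ! p \<in> first_inner \<inter> last_inner"
  have idx: "\<exists>p. ?P p \<and> x = cols ! p" if "x \<in> first_inner \<inter> last_inner" for x
    using that subsets_cols(1) by (metis IntD1 in_set_conv_nth length_path_colors subsetD)
  define p where "p = (LEAST p. ?P p)"
  have p: "?P p"
    unfolding p_def using False idx by (metis (mono_tags, lifting) LeastI ex_in_conv)
  have "first_inner \<inter> last_inner \<subseteq> {cols ! p, c {vs ! 0, vs ! (k - 1)}, c {vs ! 0, vs ! k}}"
  proof
    fix x assume "x \<in> first_inner \<inter> last_inner"
    then obtain q where q: "?P q" "x = cols ! q" using idx by blast
    have "p \<le> q" unfolding p_def using q by (auto intro: Least_le)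
    show "x \<in> {cols ! p, c {vs ! 0, vs ! (k - 1)}, c {vs ! 0, vs ! k}}"
    proof (cases "p = q")
      case False
      then have "p < q" using \<open>p \<le> q\<close> by simp
      obtain a where a: "(vs ! 0, vs ! a) \<in> parcs G" "a \<le> k" "a \<noteq> 2" "c {vs ! 0, vs ! a} = cols ! q"
        using q(1) by (auto simp: first_inner_def)
      obtain b where b: "(vs ! k, vs ! b) \<in> parcs G" "b \<le> k" "b \<noteq> k - 2" "c {vs ! k, vs ! b} = cols ! p"
        using p by (auto simp: last_inner_def)
      have "q < a"
        using first_chord_color[OF a(1-3)] a(4) q(1) dist_cols
        by (auto simp: in_set_conv_nth nth_eq_iff_index_eq)
      moreover have "b \<le> p"
        using last_chord_color[OF b(1-3)] b(4) p dist_cols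
        by (auto simp: in_set_conv_nth nth_eq_iff_index_eq)
      ultimately have "k \<le> a + 1"
        using crossing_chords a b \<open>p < q\<close> by blast
      then have "a = k - 1 \<or> a = k" using a(2) by linarith
      then show ?thesis using a(4) q(2) by auto
    qed (use q in auto)
  qed
  then show ?thesis
    by (rule order_trans[OF card_mono, rotated]) (auto simp: card_insert_if)
qed simp

lemma card_outer:
  assumes "k \<noteq> 0"
  shows "card first_outer + card last_outer
    \<le> card (pverts G - set vs) + card (first_outer \<inter> last_outer) + 1"
proof -
  let ?P = "{w. (vs ! 0, w) \<in> parcs G \<and> w \<notin> set vs}"
  let ?Q = "{w. (vs ! k, w) \<in> parcs G \<and> w \<notin> set vs}"
  show ?thesis
  proof (rule card_add_le_if_common_reps_clash)
    show "finite (pverts G - set vs)" using pair_finite_verts by simp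
    show "?P \<subseteq> pverts G - set vs" "?Q \<subseteq> pverts G - set vs" by (auto dest: in_arcsD2)
    show "first_outer \<subseteq> (\<lambda>w. c {vs ! 0, w}) ` ?P" "last_outer \<subseteq> (\<lambda>w. c {vs ! k, w}) ` ?Q"
      by (auto simp: first_outer_def last_outer_def)
  next
    fix w w' assume w: "w \<in> ?P \<inter> ?Q" "w' \<in> ?P \<inter> ?Q" "w \<noteq> w'"
    let ?us = "[vs ! 0, w, vs ! k, w']"
    have "vs ! 0 \<noteq> vs ! k"
      using dist vs_ne assms nth_eq_iff_index_eq[of vs 0 k] by simp
    moreover have "vs ! 0 \<in> set vs" "vs ! k \<in> set vs"
      using vs_ne by auto
    ultimately have ends: "vs ! 0 \<noteq> vs ! k" "vs ! 0 \<in> set vs" "vs ! k \<in> set vs"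
      by auto
    show "\<not> distinct [c {vs ! 0, w}, c {vs ! k, w}, c {vs ! k, w'}, c {vs ! 0, w'}]"
    proof
      assume d: "distinct [c {vs ! 0, w}, c {vs ! k, w}, c {vs ! k, w'}, c {vs ! 0, w'}]"
      have "rainbow_path ?us"
        using w d ends
        by (auto simp: rainbow_path_def path_colors_def insert_commute
            dest: in_arcsD1 in_arcsD2 intro: arcs_symmetric)
      then have "c {w', vs ! 0} \<in> set (path_colors ?us)"
        using closing_color_used[of ?us] w by (auto intro: arcs_symmetric)
      then show False using d by (auto simp: path_colors_def insert_commute)
    qed
  qed
qed

lemma color_degree_first: "color_degree G c (vs ! 0) \<le> card (first_inner \<union> first_outer) + 1"
proof -
  have "(\<lambda>w. c {vs ! 0, w}) ` {w. (vs ! 0, w) \<in> parcs G}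
      \<subseteq> insert (c {vs ! 0, vs ! 2}) (first_inner \<union> first_outer)"
  proof (rule image_subsetI, rule insertCI)
    fix w assume "w \<in> {w. (vs ! 0, w) \<in> parcs G}" "c {vs ! 0, w} \<notin> first_inner \<union> first_outer"
    then have w: "(vs ! 0, w) \<in> parcs G" "c {vs ! 0, w} \<notin> first_outer" "c {vs ! 0, w} \<notin> first_inner"
      by auto
    then have "w \<in> set vs" by (auto simp: first_outer_def)
    then obtain a where "w = vs ! a" "a \<le> k"
      using length_vs by (metis in_set_conv_nth less_Suc_eq_le)
    then have "a = 2" using w by (auto simp: first_inner_def)
    then show "c {vs ! 0, w} = c {vs ! 0, vs ! 2}" using \<open>w = vs ! a\<close> by simp
  qed
  moreover have "finite (first_inner \<union> first_outer)"
    using subsets_cols by (meson List.finite_set finite_UnI finite_subset)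
  ultimately show ?thesis
    unfolding color_degree_eq by (rule card_le_Suc_if_subset_insert)
qed

lemma color_degree_last: "color_degree G c (vs ! k) \<le> card (last_inner \<union> last_outer) + 1"
proof -
  have "(\<lambda>w. c {vs ! k, w}) ` {w. (vs ! k, w) \<in> parcs G}
      \<subseteq> insert (c {vs ! k, vs ! (k - 2)}) (last_inner \<union> last_outer)"
  proof (rule image_subsetI, rule insertCI)
    fix w assume "w \<in> {w. (vs ! k, w) \<in> parcs G}" "c {vs ! k, w} \<notin> last_inner \<union> last_outer"
    then have w: "(vs ! k, w) \<in> parcs G" "c {vs ! k, w} \<notin> last_outer" "c {vs ! k, w} \<notin> last_inner"
      by auto
    then have "w \<in> set vs" by (auto simp: last_outer_def)
    then obtain b where "w = vs ! b" "b \<le> k"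
      using length_vs by (metis in_set_conv_nth less_Suc_eq_le)
    then have "b = k - 2" using w by (auto simp: last_inner_def)
    then show "c {vs ! k, w} = c {vs ! k, vs ! (k - 2)}" using \<open>w = vs ! b\<close> by simp
  qed
  moreover have "finite (last_inner \<union> last_outer)"
    using subsets_cols by (meson List.finite_set finite_UnI finite_subset)
  ultimately show ?thesis
    unfolding color_degree_eq by (rule card_le_Suc_if_subset_insert)
qed

text \<open>
  The colors in \<open>first_outer \<inter> last_outer\<close>, counted twice in the bound on the outer colors, are
  paid for by the path: they are path colors that occur in neither inner set.
\<close>

lemma color_degree_sum_le:
  assumes "k \<noteq> 0"
  shows "color_degree G c (vs ! 0) + color_degree G c (vs ! k) \<le> card (pverts G) + 5"
proof -
  have fin: "finite first_inner" "finite last_inner" "finite first_outer" "finite last_outer"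
    using subsets_cols finite_subset[OF _ List.finite_set] by blast+
  have "card (first_inner \<union> first_outer) = card first_inner + card first_outer"
    "card (last_inner \<union> last_outer) = card last_inner + card last_outer"
    using fin by (intro card_Un_disjoint; auto simp: first_outer_def last_outer_def)+
  moreover have "card first_inner + card last_inner
      = card (first_inner \<union> last_inner) + card (first_inner \<inter> last_inner)"
    using fin by (intro card_Un_Int)
  moreover have "card (first_inner \<union> last_inner) + card (first_outer \<inter> last_outer) \<le> k"
  proof -
    have "card (first_inner \<union> last_inner) + card (first_outer \<inter> last_outer)
        = card ((first_inner \<union> last_inner) \<union> (first_outer \<inter> last_outer))"
      using fin by (intro card_Un_disjoint[symmetric]) (auto simp: first_outer_def last_outer_def)
    also have "\<dots> \<le> card (set cols)"
      using subsets_cols by (intro card_mono) auto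
    also have "\<dots> \<le> k" using card_length[of cols] by simp
    finally show ?thesis .
  qed
  moreover have "card (pverts G - set vs) + Suc k = card (pverts G)"
    using path length_vs card_mono[OF pair_finite_verts, of "set vs"]
    by (simp add: rainbow_path_def card_Diff_subset distinct_card)
  ultimately show ?thesis
    using card_inner_Int card_outer[OF assms] color_degree_first color_degree_last by linarith
qed

end

theorem theorem3p5:
  fixes G :: "'a pair_pre_digraph" and c :: "'a set \<Rightarrow> nat" and n :: nat
  assumes "pair_graph G"
    and "pverts G \<noteq> {}"
    and "card (pverts G) = n"
    and "\<And>v. v \<in> pverts G \<Longrightarrow> real (color_degree G c v) > (real n + 5) / 2"
  shows "\<exists>p. rainbow_cycle G c p \<and> length p \<ge> 4"
proof (rule ccontr)
  assume none: "\<nexists>p. rainbow_cycle G c p \<and> length p \<ge> 4"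
  interpret edge_colored_graph G c
    using assms(1) by (simp add: edge_colored_graph_def)
  obtain vs where vs: "rainbow_path vs" "\<And>us. rainbow_path us \<Longrightarrow> length us \<le> length vs"
    using longest_rainbow_path_exists assms(2) by blast
  interpret longest_rainbow_path G c vs
    using vs none by unfold_locales (auto simp: not_le)
  have deg: "2 * color_degree G c v \<ge> n + 6" if "v \<in> pverts G" for v
  proof -
    have "real (n + 5) < real (2 * color_degree G c v)"
      using assms(4)[OF that] by (simp add: field_simps)
    then show ?thesis unfolding of_nat_less_iff by simp
  qed
  have ends: "vs ! 0 \<in> pverts G" "vs ! k \<in> pverts G"
    using path length_vs by (auto simp: rainbow_path_def)
  \<comment> \<open>On a one-vertex path only the color set aside could occur at that vertex.\<close>
  have "k \<noteq> 0"
  proof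
    assume "k = 0"
    then have "cols = []" by (metis length_0_conv length_path_colors)
    then have "first_inner \<union> first_outer = {}" using subsets_cols by simp
    then show False using color_degree_first deg[OF ends(1)] by simp
  qed
  then show False
    using color_degree_sum_le deg[OF ends(1)] deg[OF ends(2)] assms(3) by linarith
qed

end
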